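(* Let $\{G_n\}_{n\ge 1}$ be a positive increasing integer sequence with $G_1=1$ given by the linear recurrence with constant coefficients $G_n=\alpha_1G_{n-1}+\alpha_2G_{n-2}+\cdots+\alpha_dG_{n-d}$. For the random walk on $\mathbb{Z}_{G_n}$ determined by this sequence, $t_{mix}\le\gamma n^2$ for some constant $\gamma$ (depending on the sequence).
   Context: For fixed $n$, the random walk determined by $\{G_n\}_{n\ge1}$ is the Markov chain $(X_t)_{t\ge 0}$ on $\mathbb{Z}_{G_n}=\mathbb{Z}/G_n\mathbb{Z}$ with $X_0=0$ and $X_{t+1}\equiv X_t+z_t \pmod{G_n}$, where each $z_t$ is chosen uniformly at random (independently at each step) from $\{G_1,G_2,\dots,G_n\}$. Let $P_0^t$ be the distribution of $X_t$ and $\pi$ the uniform distribution on $\mathbb{Z}_{G_n}$, which is the stationary distribution. The total variation distance between probability distributions on a finite set $S$ is $\|\mu-\eta\|_{TV}=\frac12\sum_{x\in S}|\mu(x)-\eta(x)|$. The mixing time is $t_{mix}(\epsilon)=\min\{t:\|P_0^t-\pi\|_{TV}\le\epsilon\}$, and $t_{mix}=t_{mix}(1/4)$. *)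

theory Defs
  imports "HOL-Probability.Probability"
begin

text \<open>
  The group \<open>\<int>/G\<^sub>n\<int>\<close> is represented by the residues \<open>{0..<G n}\<close>. The sequence is indexed
  from 1; the value \<open>G 0\<close> plays no role.
\<close>

definition walk_step :: "(nat \<Rightarrow> int) \<Rightarrow> nat \<Rightarrow> int \<Rightarrow> int pmf" where
  "walk_step G n x = map_pmf (\<lambda>z. (x + z) mod G n) (pmf_of_set (G ` {1..n}))"

text \<open>The law \<open>P\<^sub>0\<^sup>t\<close> of \<open>X\<^sub>t\<close>, for the chain started at \<open>X\<^sub>0 = 0\<close>.\<close>

primrec walk_dist :: "(nat \<Rightarrow> int) \<Rightarrow> nat \<Rightarrow> nat \<Rightarrow> int pmf" where
  "walk_dist G n 0 = return_pmf 0"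
| "walk_dist G n (Suc t) = bind_pmf (walk_dist G n t) (walk_step G n)"

definition tv_dist :: "'a set \<Rightarrow> 'a pmf \<Rightarrow> 'a pmf \<Rightarrow> real" where
  "tv_dist S \<mu> \<eta> = 1 / 2 * (\<Sum>x\<in>S. \<bar>pmf \<mu> x - pmf \<eta> x\<bar>)"

text \<open>
  The minimum is taken in \<^typ>\<open>enat\<close>: were the set of times empty, the mixing time would be
  \<open>\<infinity>\<close>, so an upper bound on it includes the assertion that the minimum exists.
\<close>

definition mixing_time :: "(nat \<Rightarrow> int) \<Rightarrow> nat \<Rightarrow> real \<Rightarrow> enat" where
  "mixing_time G n \<epsilon> =
     (INF t \<in> {t. tv_dist {0..<G n} (walk_dist G n t) (pmf_of_set {0..<G n}) \<le> \<epsilon>}. enat t)"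

definition t_mix :: "(nat \<Rightarrow> int) \<Rightarrow> nat \<Rightarrow> enat" where
  "t_mix G n = mixing_time G n (1 / 4)"

end

theory Submission
  imports Defs "HOL-Library.Real_Mod"
begin

text \<open>
  The recurrence enters through a growth bound: since \<open>G\<close> is increasing, all values of \<open>G\<close> on
  its right-hand side are at most the first of them, so \<open>G (n + 1) \<le> C * G n\<close> for a constant \<open>C\<close>
  (lemma \<open>linear_recurrence_bounded_ratio\<close>). The rest is the upper bound lemma of Diaconis and
  Shahshahani on the cyclic group \<open>\<int>/m\<int>\<close> with \<open>m = G n\<close>.

  The walk is a convolution power, so its Fourier coefficient at the frequency \<open>k\<close> is the
  \<open>t\<close>-th power of the mean \<open>\<phi> k\<close> of the character \<open>z \<mapsto> e(k z / m)\<close> over the step set, where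
  \<open>e(x) = exp(2 \<pi> i x)\<close> (lemma \<open>expectation_walk_dist\<close>). By Parseval and Cauchy-Schwarz the
  squared total variation distance to uniform is at most a quarter of the sum of
  \<open>\<bar>\<phi> k\<bar> ^ (2 * t)\<close> over the frequencies \<open>k \<noteq> 0\<close> (lemma \<open>tv_dist_uniform_le_fourier\<close>).

  For \<open>k \<noteq> 0\<close> let \<open>u / m\<close> be the distance from \<open>k / m\<close> to the nearest integer. It lies
  between \<open>1 / m\<close> and \<open>1 / 2\<close>, so the products \<open>u * G j / m\<close> start at or below \<open>1 / 2\<close> for
  \<open>j = 1\<close>, reach at least \<open>1\<close> for \<open>j = n\<close>, and grow by a factor of at most \<open>C\<close> at a time. The
  last one that does not exceed \<open>1 / 2\<close> is thus at least \<open>1 / (2 * C)\<close>. The corresponding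
  character value stays away from \<open>1\<close>, which is its value at the step \<open>G n\<close>. These two steps alone
  force \<open>\<bar>\<phi> k\<bar> \<le> 1 - \<delta> / n\<close> with \<open>\<delta> > 0\<close> depending only on \<open>C\<close>
  (lemma \<open>norm_mean_cyclic_char_le\<close>).

  There are fewer than \<open>G n \<le> C ^ n\<close> nonzero frequencies, so the sum is at most
  \<open>exp (n * ln C - 2 * \<delta> * t / n)\<close>, and a suitable multiple of \<open>n\<^sup>2\<close> for \<open>t\<close> makes this small:
  one factor \<open>n\<close> comes from the spectral gap, the other from the logarithm of the group order.
\<close>

section \<open>Fourier analysis on a finite cyclic group\<close>

definition cyclic_char :: "int \<Rightarrow> int \<Rightarrow> int \<Rightarrow> complex" where
  "cyclic_char m k x = cis (2 * pi * of_int (k * x) / of_int m)"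

lemma norm_cyclic_char [simp]: "norm (cyclic_char m k x) = 1"
  by (simp add: cyclic_char_def)

lemma cyclic_char_zero_left [simp]: "cyclic_char m 0 x = 1"
  by (simp add: cyclic_char_def)

lemma cyclic_char_zero_right [simp]: "cyclic_char m k 0 = 1"
  by (simp add: cyclic_char_def)

lemma cyclic_char_add: "cyclic_char m k (x + y) = cyclic_char m k x * cyclic_char m k y"
  by (simp add: cyclic_char_def cis_mult algebra_simps add_divide_distrib)

lemma cyclic_char_multiple:
  assumes "m \<noteq> 0"
  shows "cyclic_char m k (m * q) = 1"
proof -
  have "2 * pi * of_int (k * (m * q)) / of_int m = 2 * pi * of_int (k * q)"
    using assms by simp
  then show ?thesis
    unfolding cyclic_char_def by (metis cis_multiple_2pi Ints_of_int)
qed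

lemma cyclic_char_mod:
  assumes "m \<noteq> 0"
  shows "cyclic_char m k (x mod m) = cyclic_char m k x"
  using cyclic_char_add[of m k "x mod m" "m * (x div m)"] cyclic_char_multiple[OF assms]
  by simp

lemma cyclic_char_mult_cnj:
  "cyclic_char m k x * cnj (cyclic_char m k y) = cyclic_char m k (x - y)"
  by (simp add: cyclic_char_def cis_cnj cis_mult diff_divide_distrib algebra_simps)

text \<open>
  The sum is geometric with ratio \<open>e(a / m)\<close>, an \<open>m\<close>-th root of unity other than \<open>1\<close>.
\<close>

lemma sum_cyclic_char_eq_0:
  assumes "m > 0" "\<not> m dvd a"
  shows "(\<Sum>k\<in>{0..<m}. cyclic_char m k a) = 0"
proof -
  let ?w = "cyclic_char m 1 a"
  have pw: "cyclic_char m (int k) a = ?w ^ k" for k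
    by (simp add: cyclic_char_def Complex.DeMoivre mult_ac)
  have "?w \<noteq> 1"
  proof
    assume "?w = 1"
    then obtain n where "2 * pi * of_int a / of_int m = of_int n * (2 * pi)"
      unfolding cyclic_char_def cis_eq_1_iff by auto
    then have "of_int a = (of_int (n * m) :: real)"
      using assms by (simp add: field_simps)
    then have "a = n * m" by linarith
    with assms show False by simp
  qed
  moreover have "?w ^ nat m = 1"
    using pw[of "nat m"] cyclic_char_multiple[of m 1 a] assms
    by (simp add: cyclic_char_def mult.commute)
  ultimately have "(\<Sum>k<nat m. ?w ^ k) = 0"
    by (simp add: geometric_sum)
  moreover have "(\<Sum>k\<in>{0..<m}. cyclic_char m k a) = (\<Sum>k<nat m. ?w ^ k)"
    by (rule sum.reindex_bij_witness[of _ int nat]) (auto simp flip: pw)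
  ultimately show ?thesis by simp
qed

text \<open>
  Expanding the squares gives a triple sum; summing over \<open>k\<close> first kills all terms but the
  diagonal ones, by orthogonality of the characters.
\<close>

lemma parseval:
  fixes f :: "int \<Rightarrow> real"
  assumes "m > 0"
  shows "(\<Sum>k\<in>{0..<m}. (norm (\<Sum>x\<in>{0..<m}. of_real (f x) * cyclic_char m k x))\<^sup>2)
         = of_int m * (\<Sum>x\<in>{0..<m}. (f x)\<^sup>2)"
proof -
  let ?I = "{0..<m}"
  have orth: "(\<Sum>k\<in>?I. cyclic_char m k (x - y)) = (if x = y then of_int m else 0)"
    if "x \<in> ?I" "y \<in> ?I" for x y
  proof (cases "x = y")
    case False
    then have "\<not> m dvd (x - y)"
      using that by (metis atLeastLessThan_iff mod_eq_dvd_iff mod_pos_pos_trivial)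
    with False show ?thesis using sum_cyclic_char_eq_0 assms by simp
  qed (use assms in simp)
  have "complex_of_real (\<Sum>k\<in>?I. (norm (\<Sum>x\<in>?I. of_real (f x) * cyclic_char m k x))\<^sup>2)
      = (\<Sum>k\<in>?I. \<Sum>x\<in>?I. \<Sum>y\<in>?I. of_real (f x * f y) * cyclic_char m k (x - y))"
    by (simp only: of_real_sum complex_norm_square cnj_sum sum_product)
       (simp add: cyclic_char_mult_cnj[symmetric] mult_ac)
  also have "\<dots> = (\<Sum>x\<in>?I. \<Sum>y\<in>?I. \<Sum>k\<in>?I. of_real (f x * f y) * cyclic_char m k (x - y))"
    by (subst sum.swap) (intro sum.cong refl sum.swap)
  also have "\<dots> = (\<Sum>x\<in>?I. \<Sum>y\<in>?I. if x = y then of_real (f x * f y) * of_int m else 0)"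
    by (intro sum.cong refl) (auto simp: sum_distrib_left[symmetric] orth)
  also have "\<dots> = complex_of_real (of_int m * (\<Sum>x\<in>?I. (f x)\<^sup>2))"
    by (simp add: sum_distrib_left power2_eq_square mult_ac)
  finally show ?thesis using of_real_eq_iff by blast
qed

text \<open>
  Cauchy-Schwarz turns the \<open>L\<^sup>1\<close> norm of \<open>p\<close> minus the uniform law into its \<open>L\<^sup>2\<close> norm, to
  which Parseval applies. Subtracting the uniform law removes the coefficient at \<open>k = 0\<close> and
  leaves all others unchanged.
\<close>

lemma tv_dist_uniform_le_fourier:
  assumes "m > 0" "set_pmf p \<subseteq> {0..<m}"
  shows "(tv_dist {0..<m} p (pmf_of_set {0..<m}))\<^sup>2
         \<le> 1 / 4 * (\<Sum>k\<in>{1..<m}. (norm (measure_pmf.expectation p (cyclic_char m k)))\<^sup>2)"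
proof -
  let ?I = "{0..<m}"
  define f where "f x = pmf p x - pmf (pmf_of_set ?I) x" for x
  define F where "F k = (\<Sum>x\<in>?I. of_real (f x) * cyclic_char m k x)" for k
  have I: "?I \<noteq> {}" "finite ?I" using assms by auto
  have unif: "pmf (pmf_of_set ?I) x = 1 / m" if "x \<in> ?I" for x
    using that I assms by (simp add: indicator_def)
  have E: "measure_pmf.expectation p (cyclic_char m k)
           = (\<Sum>x\<in>?I. of_real (pmf p x) * cyclic_char m k x)" for k
    using assms by (subst integral_measure_pmf[of ?I]) (auto simp: scaleR_conv_of_real)
  have F_nonzero: "F k = measure_pmf.expectation p (cyclic_char m k)" if "k \<in> {1..<m}" for k
  proof -
    \<comment> \<open>Orthogonality sums over frequencies; exchanging the roles of \<open>k\<close> and \<open>x\<close> makes it a sum over residues.\<close>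
    have sym: "cyclic_char m k x = cyclic_char m x k" for x
      by (simp add: cyclic_char_def mult.commute)
    have "\<not> m dvd k" using that by (auto dest: zdvd_imp_le)
    then have "(\<Sum>x\<in>?I. cyclic_char m k x) = 0"
      unfolding sym using sum_cyclic_char_eq_0 assms by simp
    moreover have "F k = measure_pmf.expectation p (cyclic_char m k)
        - (\<Sum>x\<in>?I. of_real (1 / m) * cyclic_char m k x)"
      unfolding F_def E f_def
      unfolding sum_subtractf[symmetric]
      by (intro sum.cong refl) (simp only: unif of_real_diff left_diff_distrib)
    ultimately show ?thesis by (simp add: sum_divide_distrib[symmetric])
  qed
  have "(\<Sum>x\<in>?I. f x) = 0"
    using sum_pmf_eq_1[OF I(2) assms(2)] sum_pmf_eq_1[of ?I "pmf_of_set ?I"] I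
    by (simp add: f_def sum_subtractf)
  then have F_zero: "F 0 = 0"
    by (simp add: F_def of_real_sum[symmetric] del: of_real_sum)
  have "(tv_dist ?I p (pmf_of_set ?I))\<^sup>2 = 1 / 4 * (\<Sum>x\<in>?I. \<bar>f x\<bar>)\<^sup>2"
    by (simp add: tv_dist_def f_def power_divide)
  also have "\<dots> \<le> 1 / 4 * (of_int m * (\<Sum>x\<in>?I. (f x)\<^sup>2))"
    using sum_squared_le_sum_of_squares[of "\<lambda>x. \<bar>f x\<bar>" ?I] assms by (simp add: mult.commute)
  also have "\<dots> = 1 / 4 * (\<Sum>k\<in>?I. (norm (F k))\<^sup>2)"
    using parseval[OF assms(1), of f] by (simp add: F_def)
  also have "(\<Sum>k\<in>?I. (norm (F k))\<^sup>2) = (\<Sum>k\<in>insert 0 {1..<m}. (norm (F k))\<^sup>2)"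
    using assms by (intro sum.cong) auto
  finally show ?thesis by (simp add: F_zero F_nonzero)
qed

section \<open>Fourier transform of the walk\<close>

lemma set_pmf_walk_dist:
  assumes "G n > 0"
  shows "set_pmf (walk_dist G n t) \<subseteq> {0..<G n}"
  using assms by (induction t) (auto simp: walk_step_def)

text \<open>
  A character is multiplicative and does not see the reduction modulo \<open>G n\<close>, so each independent
  step contributes the same factor, its mean over the step set. That set counts repeated values
  of the sequence once, hence the division by its cardinality rather than by \<open>n\<close>.
\<close>

lemma expectation_walk_dist:
  assumes "n \<ge> 1" "G n > 0"
  shows "measure_pmf.expectation (walk_dist G n t) (cyclic_char (G n) k)
         = ((\<Sum>z\<in>G ` {1..n}. cyclic_char (G n) k z) / of_nat (card (G ` {1..n}))) ^ t"
proof (induction t)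
  case 0
  show ?case by simp
next
  case (Suc t)
  let ?S = "G ` {1..n}" and ?\<chi> = "cyclic_char (G n) k"
  define \<phi> where "\<phi> = (\<Sum>z\<in>?S. ?\<chi> z) / of_nat (card ?S)"
  have S: "?S \<noteq> {}" "finite ?S" using assms by auto
  note supp = set_pmf_walk_dist[of G n t, OF assms(2)]
  have step: "measure_pmf.expectation (walk_step G n x) ?\<chi> = ?\<chi> x * \<phi>" for x
  proof -
    have "measure_pmf.expectation (walk_step G n x) ?\<chi>
        = (\<Sum>z\<in>?S. ?\<chi> ((x + z) mod G n)) / of_nat (card ?S)"
      unfolding walk_step_def integral_map_pmf using S
      by (subst integral_measure_pmf[of ?S])
         (auto simp: sum_divide_distrib scaleR_conv_of_real)
    then show ?thesis
      using assms(2) by (simp add: cyclic_char_mod cyclic_char_add sum_distrib_left \<phi>_def)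
  qed
  have "measure_pmf.expectation (walk_dist G n (Suc t)) ?\<chi>
      = (\<Sum>x\<in>{0..<G n}. pmf (walk_dist G n t) x *\<^sub>R (?\<chi> x * \<phi>))"
    unfolding walk_dist.simps using supp S
    by (subst pmf_expectation_bind[of "{0..<G n}"]) (auto simp: step, simp add: walk_step_def)
  also have "\<dots> = measure_pmf.expectation (walk_dist G n t) ?\<chi> * \<phi>"
    using supp
    by (subst integral_measure_pmf[of "{0..<G n}"]) (auto simp: sum_distrib_right)
  finally show ?case using Suc by (simp add: \<phi>_def)
qed

section \<open>The spectral gap for a sequence of bounded ratio\<close>

lemma norm_one_plus_cis: "norm (1 + cis t) = 2 * \<bar>cos (t / 2)\<bar>"
proof -
  have "(norm (1 + cis t))\<^sup>2 = 2 + 2 * cos t"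
    using sin_cos_squared_add[of t]
    by (simp add: cmod_power2 power2_sum)
  also have "\<dots> = (2 * \<bar>cos (t / 2)\<bar>)\<^sup>2"
    using cos_double_cos[of "t / 2"] by (simp add: power_mult_distrib)
  finally show ?thesis by (rule power2_eq_imp_eq) auto
qed

text \<open>
  Take the last \<open>j\<close> for which \<open>u * G j / G n\<close> is at most \<open>1 / 2\<close>. It is not \<open>n\<close> because
  \<open>u \<ge> 1\<close>, so the next product exceeds \<open>1 / 2\<close>, and the ratio bound carries this back to \<open>j\<close> at
  the price of a factor \<open>C\<close>.
\<close>

lemma exists_step_far_from_integers:
  fixes G :: "nat \<Rightarrow> int" and C :: real
  assumes "G 1 = 1" "\<And>j. j \<ge> 1 \<Longrightarrow> of_int (G (Suc j)) \<le> C * of_int (G j)"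
    and "n \<ge> 1" "0 < u" "2 * u \<le> G n"
  obtains j where "j \<in> {1..n}" "2 * u * G j \<le> G n" "of_int (G n) \<le> 2 * C * of_int (u * G j)"
proof -
  define J where "J = {j\<in>{1..n}. 2 * u * G j \<le> G n}"
  define j where "j = Max J"
  have J: "finite J" "1 \<in> J" using assms by (auto simp: J_def)
  then have j: "j \<in> J" unfolding j_def by (intro Max_in) auto
  have "n \<notin> J"
  proof
    assume "n \<in> J"
    then have "2 * u * G n \<le> G n" by (simp add: J_def)
    moreover have "G n > 0" using assms(4,5) by linarith
    ultimately show False using assms(4) by (simp add: mult_le_cancel_right1)
  qed
  with j have "j < n" by (cases "j = n") (auto simp: J_def)
  moreover have "Suc j \<notin> J" using Max_ge[OF J(1), of "Suc j"] j_def by auto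
  ultimately have "G n < 2 * u * G (Suc j)" using j by (auto simp: J_def)
  then have "of_int (G n) \<le> 2 * of_int u * (of_int (G (Suc j)) :: real)"
    by (metis of_int_le_iff of_int_mult of_int_numeral less_imp_le)
  also have "\<dots> \<le> 2 * of_int u * (C * of_int (G j))"
    using assms(2)[of j] j assms(4) by (intro mult_left_mono) (auto simp: J_def)
  finally show ?thesis using j that[of j] by (auto simp: J_def mult_ac)
qed

text \<open>
  The norm is \<open>2 * \<bar>cos (\<pi> * k * z / m)\<bar>\<close>, which does not change when \<open>k\<close> is replaced by
  \<open>m - k\<close>; so \<open>k\<close> may be taken to be \<open>u\<close>, and then the angle lies between \<open>\<pi> / (2 * C)\<close> and
  \<open>\<pi> / 2\<close>, where the cosine is nonnegative and decreasing.
\<close>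

lemma norm_one_plus_cyclic_char_le:
  fixes C :: real
  assumes "m > 0" "0 < u" "k = u \<or> k = m - u" "0 < z" "2 * u * z \<le> m"
    and "of_int m \<le> 2 * C * of_int (u * z)" "C \<ge> 1"
  shows "norm (1 + cyclic_char m k z) \<le> 2 * cos (pi / (2 * C))"
proof -
  define v where "v = pi * of_int (u * z) / of_int m"
  have "\<bar>cos (pi * of_int (k * z) / of_int m)\<bar> = \<bar>cos v\<bar>"
    using assms(3)
  proof
    assume "k = m - u"
    then have "pi * of_int (k * z) / of_int m = of_int z * pi - v"
      using assms(1) by (simp add: v_def divide_simps) (simp add: algebra_simps)
    then show ?thesis by (simp add: cos_diff abs_mult sin_int_times_real flip: mult.commute)
  qed (simp add: v_def)
  moreover have "v \<le> pi / 2"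
  proof -
    have "2 * (of_int (u * z) :: real) \<le> of_int m"
      using assms(5) by (metis mult.assoc of_int_le_iff of_int_mult of_int_numeral)
    then show ?thesis using assms(1) by (simp add: v_def field_simps)
  qed
  moreover have lower: "pi / (2 * C) \<le> v"
    using assms(1,6,7) by (simp add: v_def field_simps)
  moreover have "0 \<le> pi / (2 * C)" using assms(7) by simp
  moreover have "cos v \<ge> 0" using calculation by (intro cos_ge_zero) linarith+
  moreover have "cos v \<le> cos (pi / (2 * C))"
    using calculation by (intro cos_monotone_0_pi_le) linarith+
  ultimately show ?thesis
    by (simp add: cyclic_char_def norm_one_plus_cis)
qed

text \<open>
  The triangle inequality is applied after pairing the step \<open>G n\<close>, which is trivial in the group,
  with the step \<open>G j\<close> provided by \<open>exists_step_far_from_integers\<close>; all other steps are bounded by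
  \<open>1\<close>. The exponential form of the bound is the one that is convenient to raise to a power.
\<close>

lemma norm_mean_cyclic_char_le:
  fixes G :: "nat \<Rightarrow> int" and C :: real
  assumes pos: "\<And>j. j \<ge> 1 \<Longrightarrow> G j > 0" and "G 1 = 1"
    and ratio: "\<And>j. j \<ge> 1 \<Longrightarrow> of_int (G (Suc j)) \<le> C * of_int (G j)" and "C \<ge> 1"
    and "n \<ge> 1" "k \<in> {1..<G n}"
  shows "norm ((\<Sum>z\<in>G ` {1..n}. cyclic_char (G n) k z) / of_nat (card (G ` {1..n})))
         \<le> exp (- ((2 - 2 * cos (pi / (2 * C))) / real n))"
proof -
  let ?S = "G ` {1..n}" and ?\<chi> = "cyclic_char (G n) k"
  let ?\<delta> = "2 - 2 * cos (pi / (2 * C))"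
  define u where "u = min k (G n - k)"
  have u: "0 < u" "2 * u \<le> G n" "k = u \<or> k = G n - u" using assms(6) by (auto simp: u_def min_def)
  obtain j where j: "j \<in> {1..n}" "2 * u * G j \<le> G n" "of_int (G n) \<le> 2 * C * of_int (u * G j)"
    using exists_step_far_from_integers[of G C n u, OF assms(2) ratio assms(5) u(1,2)] by blast
  have Gn: "G n > 0" and Gj: "G j > 0" using pos assms(5) j by auto
  \<comment> \<open>The pairing needs two different elements of the step set.\<close>
  have "2 * G j \<le> 2 * u * G j" using u Gj by (simp add: mult_le_cancel_right1)
  then have ne: "G j \<noteq> G n" using j(2) Gj by linarith
  have S: "finite ?S" "G n \<in> ?S" "G j \<in> ?S" using j assms(5) by auto
  have "card {G n, G j} \<le> card ?S" using S by (intro card_mono) auto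
  then have card2: "card ?S \<ge> 2" using ne by auto
  have "?S = insert (G n) (insert (G j) (?S - {G n, G j}))" using S by auto
  then have "(\<Sum>z\<in>?S. ?\<chi> z) = ?\<chi> (G n) + (?\<chi> (G j) + (\<Sum>z\<in>?S - {G n, G j}. ?\<chi> z))"
    using ne S by (metis (no_types, lifting) Diff_iff finite_Diff finite_insert insertCI
        insertE sum.insert)
  also have "?\<chi> (G n) = 1" using cyclic_char_multiple[of "G n" k 1] Gn by simp
  finally have "norm (\<Sum>z\<in>?S. ?\<chi> z)
      = norm ((1 + ?\<chi> (G j)) + (\<Sum>z\<in>?S - {G n, G j}. ?\<chi> z))"
    by (simp add: add.assoc)
  also have "\<dots> \<le> norm (1 + ?\<chi> (G j)) + norm (\<Sum>z\<in>?S - {G n, G j}. ?\<chi> z)"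
    by (rule norm_triangle_ineq)
  also have "norm (1 + ?\<chi> (G j)) \<le> 2 - ?\<delta>"
    using norm_one_plus_cyclic_char_le[OF Gn u(1,3) Gj j(2,3) assms(4)] by simp
  also have "norm (\<Sum>z\<in>?S - {G n, G j}. ?\<chi> z) \<le> real (card (?S - {G n, G j}))"
    by (rule order_trans[OF norm_sum]) simp
  also have "real (card (?S - {G n, G j})) = real (card ?S) - 2"
    using S ne card2 by (subst card_Diff_subset) auto
  finally have le: "norm (\<Sum>z\<in>?S. ?\<chi> z) \<le> real (card ?S) - ?\<delta>" by simp
  have "norm ((\<Sum>z\<in>?S. ?\<chi> z) / of_nat (card ?S)) = norm (\<Sum>z\<in>?S. ?\<chi> z) / real (card ?S)"
    by (simp add: norm_divide)
  also have "\<dots> \<le> (real (card ?S) - ?\<delta>) / real (card ?S)"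
    by (intro divide_right_mono le) simp
  also have "\<dots> = 1 - ?\<delta> / real (card ?S)"
    using card2 assms(5) by (simp add: diff_divide_distrib)
  also have "\<dots> \<le> 1 - ?\<delta> / real n"
  proof -
    have "card ?S \<le> n" using card_image_le[of "{1..n}" G] by simp
    then show ?thesis using card2 assms(5) by (intro diff_left_mono divide_left_mono) auto
  qed
  also have "\<dots> \<le> exp (- (?\<delta> / real n))"
    using exp_ge_add_one_self[of "- (?\<delta> / real n)"] by simp
  finally show ?thesis .
qed

section \<open>Mixing in quadratic time\<close>

lemma bounded_ratio_imp_le_power:
  fixes G :: "nat \<Rightarrow> int" and C :: real
  assumes "G 1 = 1" "\<And>j. j \<ge> 1 \<Longrightarrow> of_int (G (Suc j)) \<le> C * of_int (G j)" "C \<ge> 1" "n \<ge> 1"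
  shows "of_int (G n) \<le> C ^ n"
  using assms(4)
proof (induction n rule: dec_induct)
  case base
  show ?case using assms by simp
next
  case (step n)
  have "of_int (G (Suc n)) \<le> C * of_int (G n)" using assms(2) step.hyps by simp
  also have "\<dots> \<le> C * C ^ n" using step.IH assms(3) by (intro mult_left_mono) auto
  finally show ?case by simp
qed

text \<open>
  At time \<open>K * n\<^sup>2\<close> every nonzero frequency contributes at most \<open>exp (- 2 * \<delta> * K) ^ n\<close>, and there
  are at most \<open>C ^ n\<close> of them. The condition on \<open>K\<close> says exactly that the product of the two bases
  is at most \<open>1 / 4\<close>.
\<close>

lemma tv_dist_walk_le_quarter:
  fixes G :: "nat \<Rightarrow> int" and C :: real
  assumes pos: "\<And>j. j \<ge> 1 \<Longrightarrow> G j > 0" and "G 1 = 1"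
    and ratio: "\<And>j. j \<ge> 1 \<Longrightarrow> of_int (G (Suc j)) \<le> C * of_int (G j)" and "C \<ge> 1"
    and "n \<ge> 1"
    and K: "ln (4 * C) \<le> 2 * (2 - 2 * cos (pi / (2 * C))) * real K"
  shows "tv_dist {0..<G n} (walk_dist G n (K * n\<^sup>2)) (pmf_of_set {0..<G n}) \<le> 1 / 4"
proof -
  define \<delta> where "\<delta> = 2 - 2 * cos (pi / (2 * C))"
  let ?t = "K * n\<^sup>2" and ?m = "G n"
  let ?tv = "tv_dist {0..<?m} (walk_dist G n ?t) (pmf_of_set {0..<?m})"
  have m: "?m > 0" using pos assms(5) by simp
  have exponent: "(exp (- (\<delta> / real n)) ^ ?t)\<^sup>2 = exp (- (2 * \<delta> * real K)) ^ n"
    using assms(5)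
    by (simp add: exp_of_nat_mult[symmetric] power2_eq_square exp_add[symmetric] algebra_simps)
  have coeff: "(norm (measure_pmf.expectation (walk_dist G n ?t) (cyclic_char ?m k)))\<^sup>2
      \<le> exp (- (2 * \<delta> * real K)) ^ n" if "k \<in> {1..<?m}" for k
    unfolding expectation_walk_dist[of n G, OF assms(5) m] norm_power exponent[symmetric]
    by (intro power_mono norm_mean_cyclic_char_le[of G C, OF pos assms(2) ratio assms(4,5) that, folded \<delta>_def]) auto
  have "?tv\<^sup>2 \<le> 1 / 4 * (\<Sum>k\<in>{1..<?m}.
      (norm (measure_pmf.expectation (walk_dist G n ?t) (cyclic_char ?m k)))\<^sup>2)"
    by (rule tv_dist_uniform_le_fourier[OF m set_pmf_walk_dist[of G n, OF m]])
  also have "\<dots> \<le> 1 / 4 * (\<Sum>k\<in>{1..<?m}. exp (- (2 * \<delta> * real K)) ^ n)"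
    by (intro mult_left_mono sum_mono coeff) auto
  also have "\<dots> \<le> 1 / 4 * (C ^ n * exp (- (2 * \<delta> * real K)) ^ n)"
  proof -
    have "real (nat (?m - 1)) \<le> C ^ n"
      using bounded_ratio_imp_le_power[of G C, OF assms(2) ratio assms(4,5)] m by simp
    then show ?thesis by (simp add: mult_right_mono)
  qed
  also have "\<dots> = 1 / 4 * (C * exp (- (2 * \<delta> * real K))) ^ n"
    by (simp add: power_mult_distrib)
  also have "\<dots> \<le> 1 / 4 * (1 / 4) ^ n"
  proof -
    have "exp (ln (4 * C)) \<le> exp (2 * \<delta> * real K)"
      using K by (simp only: \<delta>_def exp_le_cancel_iff)
    then have "4 * C \<le> exp (2 * \<delta> * real K)" using assms(4) by simp
    then have "C * exp (- (2 * \<delta> * real K)) \<le> 1 / 4"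
      by (simp add: exp_minus field_simps)
    then show ?thesis using assms(4) by (intro mult_left_mono power_mono) auto
  qed
  also have "\<dots> \<le> (1 / 4)\<^sup>2"
    using power_decreasing[of 1 n "1 / 4 :: real"] assms(5) by (simp add: power2_eq_square)
  finally show ?thesis by (rule power2_le_imp_le) simp
qed

lemma t_mix_quadratic_of_bounded_ratio:
  fixes G :: "nat \<Rightarrow> int" and C :: real
  assumes "\<And>j. j \<ge> 1 \<Longrightarrow> G j > 0" "G 1 = 1"
    and "\<And>j. j \<ge> 1 \<Longrightarrow> of_int (G (Suc j)) \<le> C * of_int (G j)" and "C \<ge> 1"
  obtains K where "\<And>n. n \<ge> 1 \<Longrightarrow> t_mix G n \<le> enat (K * n\<^sup>2)"
proof -
  define \<delta> where "\<delta> = 2 * (2 - 2 * cos (pi / (2 * C)))"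
  have "pi / (2 * C) < 2 * pi" "0 < pi / (2 * C)"
    using assms(4) by (auto simp: field_simps)
  then have "cos (pi / (2 * C)) < cos 0"
    using assms(4) by (intro cos_monotone_0_pi) (auto simp: field_simps)
  then have "\<delta> > 0" by (simp add: \<delta>_def)
  obtain K :: nat where "ln (4 * C) / \<delta> \<le> real K" using real_arch_simple by blast
  then have "ln (4 * C) \<le> \<delta> * real K" using \<open>\<delta> > 0\<close> by (simp add: field_simps)
  then have "t_mix G n \<le> enat (K * n\<^sup>2)" if "n \<ge> 1" for n
    unfolding t_mix_def mixing_time_def
    using tv_dist_walk_le_quarter[of G C n K, OF assms that]
    by (intro INF_lower) (simp add: \<delta>_def)
  then show ?thesis using that by blast
qed

text \<open>
  From the index \<open>d\<close> on, the sum of the \<open>\<bar>\<alpha> i\<bar>\<close> bounds the ratio, because by monotonicity each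
  term of the recurrence is at most \<open>\<bar>\<alpha> i\<bar>\<close> times the preceding value. The initial segment
  is absorbed by adding \<open>G (d + 1)\<close> to the constant, as all values are at least \<open>1\<close>.
\<close>

lemma linear_recurrence_bounded_ratio:
  fixes G :: "nat \<Rightarrow> int" and \<alpha> :: "nat \<Rightarrow> real"
  assumes pos: "\<And>n. n \<ge> 1 \<Longrightarrow> G n > 0" and mono: "mono_on {1..} G"
    and rec: "\<And>n. n > d \<Longrightarrow> real_of_int (G n) = (\<Sum>i = 1..d. \<alpha> i * real_of_int (G (n - i)))"
  obtains C :: real where "C \<ge> 1" "\<And>j. j \<ge> 1 \<Longrightarrow> of_int (G (Suc j)) \<le> C * of_int (G j)"
proof
  define A where "A = (\<Sum>i = 1..d. \<bar>\<alpha> i\<bar>)"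
  have A: "A \<ge> 0" by (simp add: A_def sum_nonneg)
  have Gd: "G (Suc d) \<ge> 1" using pos[of "Suc d"] by simp
  show "of_int (G (Suc d)) + A \<ge> 1" using A Gd by linarith
  fix j :: nat
  assume j: "j \<ge> 1"
  have Gj: "real_of_int (G j) \<ge> 1" using pos[OF j] by simp
  show "of_int (G (Suc j)) \<le> (of_int (G (Suc d)) + A) * of_int (G j)"
  proof (cases "j < d")
    case True
    have "G (Suc j) \<le> G (Suc d)" using True by (intro mono_onD[OF mono]) auto
    then have "of_int (G (Suc j)) \<le> (of_int (G (Suc d)) + A) * 1" using A by simp
    also have "\<dots> \<le> (of_int (G (Suc d)) + A) * of_int (G j)"
      using A Gd Gj by (intro mult_left_mono) auto
    finally show ?thesis .
  next
    case False
    have "of_int (G (Suc j)) = (\<Sum>i = 1..d. \<alpha> i * of_int (G (Suc j - i)))"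
      using rec[of "Suc j"] False by simp
    also have "\<dots> \<le> (\<Sum>i = 1..d. \<bar>\<alpha> i\<bar> * of_int (G j))"
    proof (rule sum_mono)
      fix i
      assume i: "i \<in> {1..d}"
      have "G (Suc j - i) \<le> G j" using i False by (intro mono_onD[OF mono]) auto
      moreover have "G (Suc j - i) > 0" using i False by (intro pos) auto
      ultimately show "\<alpha> i * of_int (G (Suc j - i)) \<le> \<bar>\<alpha> i\<bar> * of_int (G j)"
        by (intro mult_mono) auto
    qed
    also have "\<dots> = A * of_int (G j)" by (simp add: A_def sum_distrib_right)
    also have "\<dots> \<le> (of_int (G (Suc d)) + A) * of_int (G j)"
      using Gd Gj by (intro mult_right_mono) auto
    finally show ?thesis .
  qed
qed

theorem corollary3p2:
  fixes G :: "nat \<Rightarrow> int" and d :: nat and \<alpha> :: "nat \<Rightarrow> real"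
  assumes "\<And>n. n \<ge> 1 \<Longrightarrow> G n > 0"
    and "mono_on {1..} G"
    and "G 1 = 1"
    and "d \<ge> 1"
    and "\<And>n. n > d \<Longrightarrow> real_of_int (G n) = (\<Sum>i = 1..d. \<alpha> i * real_of_int (G (n - i)))"
  shows "\<exists>\<gamma>::real. \<forall>n\<ge>1. ereal_of_enat (t_mix G n) \<le> ereal (\<gamma> * (real n)\<^sup>2)"
proof -
  obtain C :: real where "C \<ge> 1" "\<And>j. j \<ge> 1 \<Longrightarrow> of_int (G (Suc j)) \<le> C * of_int (G j)"
    using linear_recurrence_bounded_ratio[of G, OF assms(1,2,5)] by blast
  then obtain K where K: "\<And>n. n \<ge> 1 \<Longrightarrow> t_mix G n \<le> enat (K * n\<^sup>2)"
    using t_mix_quadratic_of_bounded_ratio[of G C, OF assms(1,3)] by blast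
  have "ereal_of_enat (t_mix G n) \<le> ereal (real K * (real n)\<^sup>2)" if "n \<ge> 1" for n
  proof -
    have "ereal_of_enat (t_mix G n) \<le> ereal_of_enat (enat (K * n\<^sup>2))"
      using K[OF that] by (simp only: ereal_of_enat_le_iff)
    then show ?thesis by simp
  qed
  then show ?thesis by blast
qed

end
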